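(* Let $\mathbb{F}$ be an algebraically closed field and $N\ge2$. Let $\sigma_0,\ldots,\sigma_{N-1}\in\mathbb{F}$, let $\xi_1,\ldots,\xi_N\in(\mathbb{F}\cup\{\infty\})\setminus\{0\}$, let $\beta_0,\ldots,\beta_N\in\mathbb{F}$ be nonzero, and let $D_0,\ldots,D_N\in\mathbb{F}^{m\times m}$. Put $$g_i(\lambda)=\beta_i(1-\lambda/\xi_i),\quad h_j(\lambda)=\lambda-\sigma_j,\quad b_0(\lambda)=\frac1{\beta_0},\quad b_i(\lambda)=\frac1{\beta_0}\prod_{k=1}^{i}\frac{h_{k-1}(\lambda)}{g_k(\lambda)},$$ for $i=1,\ldots,N$ and $j=0,\ldots,N-1$, and let $Q_N(\lambda)=\sum_{i=0}^Nb_i(\lambda)D_i\in\mathbb{F}(\lambda)^{m\times m}$ and $L_N(\lambda)=\begin{bmatrix} M_N(\lambda) \\ K_N(\lambda) \end{bmatrix}$, where $$M_N(\lambda)=\begin{bmatrix}\frac{g_N(\lambda)}{\beta_N}D_0&\cdots&\frac{g_N(\lambda)}{\beta_N}D_{N-2}&\frac{g_N(\lambda)}{\beta_N}D_{N-1}+\frac{h_{N-1}(\lambda)}{\beta_N}D_N\end{bmatrix},$$ $$K_N(\lambda)=\begin{bmatrix}-h_0(\lambda)&g_1(\lambda) \\ &-h_1(\lambda)&g_2(\lambda) \\ &&\ddots&\ddots \\ &&&-h_{N-2}(\lambda)&g_{N-1}(\lambda)\end{bmatrix}\otimes I_m.$$ Let $A_N(\lambda)$ be the $m(N-1)\times m(N-1)$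 submatrix obtained from $K_N(\lambda)$ by removing its first block column (its first $m$ columns), let $$R_N(\lambda)=\sum_{j=1}^{N-1}\left(\prod_{k=j+1}^{N}\frac{g_k(\lambda)}{h_{k-1}(\lambda)}\right)D_j+D_N\in\mathbb{F}(\lambda)^{m\times m},$$ let $\mathcal{P}_{N-1}$ be the set of finite poles in the list $(\xi_1,\ldots,\xi_{N-1})$, and assume $\xi_i\ne\sigma_j$ for $1\le i\le N$, $0\le j\le N-1$. If $R_N(\xi_k)\in\mathbb{F}^{m\times m}$ is nonsingular for every $\xi_k\in\mathcal{P}_{N-1}$, then $L_N(\lambda)$ is a linearization of $Q_N(\lambda)$ with state matrix $A_N(\lambda)$ in $\mathbb{F}$, if $\xi_N=\infty$, or in $\mathbb{F}\setminus\{\xi_N\}$, if $\xi_N$ is finite.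
   Context: Convention: $\lambda/\xi_i:=0$ if $\xi_i=\infty$; the $\xi_i$ are called poles and $\mathcal{P}_{N-1}=\{\xi_i:1\le i\le N-1,\ \xi_i\neq\infty\}$. A polynomial matrix partitioned as $P(\lambda)=\begin{bmatrix} D(\lambda) & -C(\lambda) \\ B(\lambda) & A(\lambda) \end{bmatrix}$, with $A(\lambda)$ of size $n\times n$ and $\det A(\lambda)\not\equiv0$, is called a polynomial system matrix with state matrix $A(\lambda)$; its transfer function matrix is the Schur complement $D(\lambda)+C(\lambda)A(\lambda)^{-1}B(\lambda)$; it is linear if it has degree at most $1$. It is minimal at $\lambda_0\in\mathbb{F}$ if $\operatorname{rank}\begin{bmatrix} A(\lambda_0) \\ C(\lambda_0) \end{bmatrix}=\operatorname{rank}\begin{bmatrix} A(\lambda_0) & B(\lambda_0) \end{bmatrix}=n$. For $L_N(\lambda)$ with state matrix $A_N(\lambda)$, the block $D(\lambda)$ is the first $m$ columns of $M_N$, $-C(\lambda)$ the remaining columns of $M_N$, and $B(\lambda)$ the first $m$ columns of $K_N$. A square rational matrix is regular at $\lambda_0\in\mathbb{F}$ if no entry has a pole at $\lambda_0$ and its determinant is nonzero at $\lambda_0$. A linear polynomial system matrix $\mathcal{L}(\lambda)\in\mathbb{F}[\lambda]^{(n+q)\times(n+t)}$ with state matrix $A(\lambda)\in\mathbb{F}[\lambda]^{n\times n}$ and transfer function matrix $\widehat G(\lambda)\in\mathbb{F}(\lambda)^{q\times t}$ is a linearization of $G(\lambda)\in\mathbb{F}(\lambda)^{p\times m}$ with state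 matrix $A(\lambda)$ in a nonempty set $\Sigma\subseteq\mathbb{F}$ if for each $\lambda_0\in\Sigma$: $\mathcal{L}$ is minimal at $\lambda_0$, and there exist integers $s_1,s_2\ge0$ with $s_1-s_2=q-p=t-m$ and rational matrices $R_1,R_2$ regular at $\lambda_0$, of sizes $p+s_1$ and $m+s_1$, such that $R_1\,\mathrm{diag}(G,I_{s_1})\,R_2=\mathrm{diag}(\widehat G,I_{s_2})$. *)

theory Defs
  imports
    "HOL-Computational_Algebra.Polynomial_Factorial"
    "Jordan_Normal_Form.Gauss_Jordan_Elimination"
    "Jordan_Normal_Form.DL_Rank"
begin

section \<open>Rational functions\<close>

text \<open>Elements of \<open>\<bbbF>(\<lambda>)\<close> have type \<^typ>\<open>'a poly fract\<close>. A rational function is defined at \<open>x\<close> iff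
  it can be written with a denominator not vanishing at \<open>x\<close>; the lemma \<open>has_pole_Fract_coprime\<close>
  relates this to the zeros of the denominator of a reduced fraction.\<close>

definition has_pole :: "'a::field poly fract \<Rightarrow> 'a \<Rightarrow> bool" where
  "has_pole f x \<longleftrightarrow> \<not> (\<exists>p q. poly q x \<noteq> 0 \<and> f = Fract p q)"

text \<open>The value is unspecified at a pole.\<close>

definition rat_eval :: "'a::field poly fract \<Rightarrow> 'a \<Rightarrow> 'a" where
  "rat_eval f x = (THE v. \<exists>p q. poly q x \<noteq> 0 \<and> f = Fract p q \<and> v = poly p x / poly q x)"

lemma has_pole_Fract_coprime:
  fixes p q :: "'a::field poly"
  assumes "q \<noteq> 0" "coprime p q"
  shows "has_pole (Fract p q) x \<longleftrightarrow> poly q x = 0"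
proof
  assume "has_pole (Fract p q) x"
  then show "poly q x = 0" unfolding has_pole_def by blast
next
  assume z: "poly q x = 0"
  show "has_pole (Fract p q) x"
    unfolding has_pole_def
  proof safe
    fix p' q' :: "'a poly"
    assume nz: "poly q' x \<noteq> 0" and eq: "Fract p q = Fract p' q'"
    have "q' \<noteq> 0" using nz by auto
    then have "p * q' = p' * q" using eq assms(1) by (simp add: eq_fract(1))
    then have "poly p x * poly q' x = poly p' x * poly q x" by (metis poly_mult)
    then have "poly p x = 0" using z nz by simp
    then have "[:-x, 1:] dvd p" "[:-x, 1:] dvd q" using z by (simp_all add: poly_eq_0_iff_dvd)
    then have "is_unit [:-x, 1:]" using assms(2) coprime_common_divisor by blast
    then show False by (simp add: is_unit_iff_degree)
  qed
qed

lemma rat_eval_Fract: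
  fixes p q :: "'a::field poly"
  assumes "poly q x \<noteq> 0"
  shows "rat_eval (Fract p q) x = poly p x / poly q x"
  unfolding rat_eval_def
proof (rule the_equality)
  show "\<exists>p' q'. poly q' x \<noteq> 0 \<and> Fract p q = Fract p' q' \<and> poly p x / poly q x = poly p' x / poly q' x"
    using assms by blast
next
  fix v
  assume "\<exists>p' q'. poly q' x \<noteq> 0 \<and> Fract p q = Fract p' q' \<and> v = poly p' x / poly q' x"
  then obtain p' q' where *: "poly q' x \<noteq> 0" "Fract p q = Fract p' q'" "v = poly p' x / poly q' x"
    by blast
  have "q \<noteq> 0" "q' \<noteq> 0" using assms * by auto
  then have "p * q' = p' * q" using *(2) by (simp add: eq_fract(1))
  then have "poly p x * poly q' x = poly p' x * poly q x" by (metis poly_mult)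
  then show "v = poly p x / poly q x" using * assms by (simp add: frac_eq_eq)
qed

definition rational_regular_at :: "'a::field poly fract mat \<Rightarrow> 'a \<Rightarrow> bool" where
  "rational_regular_at R x \<longleftrightarrow> square_mat R \<and>
     (\<forall>i < dim_row R. \<forall>j < dim_col R. \<not> has_pole (R $$ (i, j)) x) \<and>
     rat_eval (det R) x \<noteq> 0"

abbreviation poly_mat_eval :: "'a::field poly mat \<Rightarrow> 'a \<Rightarrow> 'a mat" where
  "poly_mat_eval P x \<equiv> map_mat (\<lambda>p. poly p x) P"

abbreviation rat_mat_eval :: "'a::field poly fract mat \<Rightarrow> 'a \<Rightarrow> 'a mat" where
  "rat_mat_eval R x \<equiv> map_mat (\<lambda>f. rat_eval f x) R"

abbreviation rat_const :: "'a::field \<Rightarrow> 'a poly fract" where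
  "rat_const a \<equiv> to_fract [:a:]"


section \<open>Polynomial system matrices and linearizations\<close>

text \<open>Given \<open>P\<close> and \<open>A\<close> there is at most one choice of \<open>D\<close>, \<open>C\<close>, \<open>B\<close>, see
  \<open>polynomial_system_matrix_unique\<close> below.\<close>

definition polynomial_system_matrix ::
    "'a::field poly mat \<Rightarrow> 'a poly mat \<Rightarrow> 'a poly mat \<Rightarrow> 'a poly mat \<Rightarrow> 'a poly mat \<Rightarrow> bool" where
  "polynomial_system_matrix P D C B A \<longleftrightarrow>
     (\<exists>n q t. D \<in> carrier_mat q t \<and> C \<in> carrier_mat q n \<and>
              B \<in> carrier_mat n t \<and> A \<in> carrier_mat n n) \<and>
     P = four_block_mat D (- C) B A \<and> det A \<noteq> 0"

lemma polynomial_system_matrix_unique: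
  assumes "polynomial_system_matrix P D C B A" "polynomial_system_matrix P D' C' B' A"
  shows "D' = D \<and> C' = C \<and> B' = B"
proof -
  from assms(1) obtain n q t where c:
    "D \<in> carrier_mat q t" "C \<in> carrier_mat q n" "B \<in> carrier_mat n t" "A \<in> carrier_mat n n"
    and P: "P = four_block_mat D (- C) B A"
    unfolding polynomial_system_matrix_def by blast
  from assms(2) obtain n' q' t' where c':
    "D' \<in> carrier_mat q' t'" "C' \<in> carrier_mat q' n'" "B' \<in> carrier_mat n' t'" "A \<in> carrier_mat n' n'"
    and P': "P = four_block_mat D' (- C') B' A"
    unfolding polynomial_system_matrix_def by blast
  have n: "n' = n" using carrier_matD(1)[OF c(4)] carrier_matD(1)[OF c'(4)] by simp
  note d = c[THEN carrier_matD(1)] c[THEN carrier_matD(2)]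
    c'[THEN carrier_matD(1)] c'[THEN carrier_matD(2)]
  have "dim_row P = q + n" "dim_col P = t + n"
    unfolding P using d by simp_all
  moreover have "dim_row P = q' + n'" "dim_col P = t' + n'"
    unfolding P' using d by simp_all
  ultimately have e: "q' = q" "t' = t" using n by simp_all
  have eq: "four_block_mat D' (- C') B' A = four_block_mat D (- C) B A"
    using P P' by simp
  have i: "D' $$ (i, j) = D $$ (i, j)" if "i < q" "j < t" for i j
    using that d n e arg_cong[OF eq, of "\<lambda>M. M $$ (i, j)"] by simp
  have ii: "C' $$ (i, j) = C $$ (i, j)" if "i < q" "j < n" for i j
    using that d n e arg_cong[OF eq, of "\<lambda>M. M $$ (i, j + t)"] by simp
  have iii: "B' $$ (i, j) = B $$ (i, j)" if "i < n" "j < t" for i j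
    using that d n e arg_cong[OF eq, of "\<lambda>M. M $$ (i + q, j)"] by simp
  show ?thesis using i ii iii d n e by (auto intro!: eq_matI)
qed

definition transfer_function ::
    "'a::field poly mat \<Rightarrow> 'a poly mat \<Rightarrow> 'a poly mat \<Rightarrow> 'a poly mat \<Rightarrow> 'a poly fract mat" where
  "transfer_function D C B A =
     map_mat to_fract D +
     map_mat to_fract C * the (mat_inverse (map_mat to_fract A)) * map_mat to_fract B"

definition linear_poly_mat :: "'a::field poly mat \<Rightarrow> bool" where
  "linear_poly_mat P \<longleftrightarrow> (\<forall>i < dim_row P. \<forall>j < dim_col P. degree (P $$ (i, j)) \<le> 1)"

abbreviation matrix_rank :: "'a::field mat \<Rightarrow> nat" where
  "matrix_rank A \<equiv> vec_space.rank (dim_row A) A"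

definition minimal_at ::
    "'a::field poly mat \<Rightarrow> 'a poly mat \<Rightarrow> 'a poly mat \<Rightarrow> 'a \<Rightarrow> bool" where
  "minimal_at C B A x \<longleftrightarrow>
     matrix_rank (poly_mat_eval (A @\<^sub>r C) x) = dim_row A \<and>
     matrix_rank (poly_mat_eval
       (four_block_mat A B (0\<^sub>m 0 (dim_col A)) (0\<^sub>m 0 (dim_col B))) x) = dim_row A"

definition is_linearization ::
    "'a::field poly mat \<Rightarrow> 'a poly mat \<Rightarrow> 'a poly fract mat \<Rightarrow> 'a set \<Rightarrow> bool" where
  "is_linearization L A G \<Sigma> \<longleftrightarrow> \<Sigma> \<noteq> {} \<and> linear_poly_mat L \<and>
     (\<exists>D C B. polynomial_system_matrix L D C B A \<and>
       (let p = dim_row G; m = dim_col G; q = dim_row D; t = dim_col D;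
            Gh = transfer_function D C B A
        in \<forall>x\<in>\<Sigma>. minimal_at C B A x \<and>
             (\<exists>s1 s2 R1 R2.
                int s1 - int s2 = int q - int p \<and> int q - int p = int t - int m \<and>
                R1 \<in> carrier_mat (p + s1) (p + s1) \<and> rational_regular_at R1 x \<and>
                R2 \<in> carrier_mat (m + s1) (m + s1) \<and> rational_regular_at R2 x \<and>
                R1 * diag_block_mat [G, 1\<^sub>m s1] * R2 = diag_block_mat [Gh, 1\<^sub>m s2])))"


section \<open>The rational matrix and its pencil\<close>

text \<open>The one-point extension of the field, in which the \<open>\<xi>\<^sub>i\<close> are taken.\<close>

datatype 'a ext_point = Finite 'a | Infinity

text \<open>The polynomial \<open>\<lambda>/\<xi>\<close>, with the convention \<open>\<lambda>/\<infinity> = 0\<close>.\<close>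

primrec var_over :: "'a::field ext_point \<Rightarrow> 'a poly" where
  "var_over (Finite x) = [:0, 1 / x:]"
| "var_over Infinity = 0"

definition g_poly :: "(nat \<Rightarrow> 'a::field) \<Rightarrow> (nat \<Rightarrow> 'a ext_point) \<Rightarrow> nat \<Rightarrow> 'a poly" where
  "g_poly \<beta> \<xi> i = Polynomial.smult (\<beta> i) (1 - var_over (\<xi> i))"

definition h_poly :: "(nat \<Rightarrow> 'a::field) \<Rightarrow> nat \<Rightarrow> 'a poly" where
  "h_poly \<sigma> j = [:- \<sigma> j, 1:]"

definition b_fun ::
    "(nat \<Rightarrow> 'a::field) \<Rightarrow> (nat \<Rightarrow> 'a ext_point) \<Rightarrow> (nat \<Rightarrow> 'a) \<Rightarrow> nat \<Rightarrow> 'a poly fract" where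
  "b_fun \<beta> \<xi> \<sigma> i =
     rat_const (1 / \<beta> 0) * (\<Prod>k=1..i. to_fract (h_poly \<sigma> (k - 1)) / to_fract (g_poly \<beta> \<xi> k))"

definition finite_poles :: "(nat \<Rightarrow> 'a ext_point) \<Rightarrow> nat \<Rightarrow> 'a set" where
  "finite_poles \<xi> n = {x. \<exists>i\<in>{1..n}. \<xi> i = Finite x}"

text \<open>Below, \<open>m\<close> is the size of the coefficient matrices
  \<open>D\<^sub>0, \<dots>, D\<^sub>N\<close>. Entry \<open>(r, c)\<close> of a matrix built from \<open>m \<times> m\<close> blocks lies in block
  \<open>(r div m, c div m)\<close> at position \<open>(r mod m, c mod m)\<close>; all indices start at \<open>0\<close>.\<close>

definition Q_mat ::
    "(nat \<Rightarrow> 'a::field) \<Rightarrow> (nat \<Rightarrow> 'a ext_point) \<Rightarrow> (nat \<Rightarrow> 'a) \<Rightarrow> (nat \<Rightarrow> 'a mat) \<Rightarrow>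
     nat \<Rightarrow> nat \<Rightarrow> 'a poly fract mat" where
  "Q_mat \<beta> \<xi> \<sigma> D m N = mat m m (\<lambda>(r, c). \<Sum>i=0..N. b_fun \<beta> \<xi> \<sigma> i * rat_const (D i $$ (r, c)))"

definition M_mat ::
    "(nat \<Rightarrow> 'a::field) \<Rightarrow> (nat \<Rightarrow> 'a ext_point) \<Rightarrow> (nat \<Rightarrow> 'a) \<Rightarrow> (nat \<Rightarrow> 'a mat) \<Rightarrow>
     nat \<Rightarrow> nat \<Rightarrow> 'a poly mat" where
  "M_mat \<beta> \<xi> \<sigma> D m N = mat m (m * N) (\<lambda>(r, c).
     let j = c div m; s = c mod m in
       Polynomial.smult (1 / \<beta> N) (g_poly \<beta> \<xi> N) * [:D j $$ (r, s):] +
       (if j = N - 1 then Polynomial.smult (1 / \<beta> N) (h_poly \<sigma> (N - 1)) * [:D N $$ (r, s):] else 0))"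

definition kronecker :: "'a::semiring_0 mat \<Rightarrow> 'a mat \<Rightarrow> 'a mat" where
  "kronecker A B = mat (dim_row A * dim_row B) (dim_col A * dim_col B)
     (\<lambda>(i, j). A $$ (i div dim_row B, j div dim_col B) * B $$ (i mod dim_row B, j mod dim_col B))"

text \<open>Row \<open>i\<close> (from \<open>0\<close>) of the scalar bidiagonal factor is
  \<open>-h\<^sub>i\<close> in column \<open>i\<close>, \<open>g\<^bsub>i+1\<^esub>\<close> in column \<open>i + 1\<close>.\<close>

definition K_mat ::
    "(nat \<Rightarrow> 'a::field) \<Rightarrow> (nat \<Rightarrow> 'a ext_point) \<Rightarrow> (nat \<Rightarrow> 'a) \<Rightarrow> nat \<Rightarrow> nat \<Rightarrow> 'a poly mat" where
  "K_mat \<beta> \<xi> \<sigma> m N = kronecker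
     (mat (N - 1) N (\<lambda>(i, j).
        if j = i then - h_poly \<sigma> i else if j = i + 1 then g_poly \<beta> \<xi> (i + 1) else 0))
     (1\<^sub>m m)"

definition L_mat ::
    "(nat \<Rightarrow> 'a::field) \<Rightarrow> (nat \<Rightarrow> 'a ext_point) \<Rightarrow> (nat \<Rightarrow> 'a) \<Rightarrow> (nat \<Rightarrow> 'a mat) \<Rightarrow>
     nat \<Rightarrow> nat \<Rightarrow> 'a poly mat" where
  "L_mat \<beta> \<xi> \<sigma> D m N = M_mat \<beta> \<xi> \<sigma> D m N @\<^sub>r K_mat \<beta> \<xi> \<sigma> m N"

definition A_mat ::
    "(nat \<Rightarrow> 'a::field) \<Rightarrow> (nat \<Rightarrow> 'a ext_point) \<Rightarrow> (nat \<Rightarrow> 'a) \<Rightarrow> nat \<Rightarrow> nat \<Rightarrow> 'a poly mat" where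
  "A_mat \<beta> \<xi> \<sigma> m N =
     mat (m * (N - 1)) (m * (N - 1)) (\<lambda>(i, j). K_mat \<beta> \<xi> \<sigma> m N $$ (i, j + m))"

definition R_mat ::
    "(nat \<Rightarrow> 'a::field) \<Rightarrow> (nat \<Rightarrow> 'a ext_point) \<Rightarrow> (nat \<Rightarrow> 'a) \<Rightarrow> (nat \<Rightarrow> 'a mat) \<Rightarrow>
     nat \<Rightarrow> nat \<Rightarrow> 'a poly fract mat" where
  "R_mat \<beta> \<xi> \<sigma> D m N = mat m m (\<lambda>(r, c).
     (\<Sum>j=1..N - 1.
        (\<Prod>k=j+1..N. to_fract (g_poly \<beta> \<xi> k) / to_fract (h_poly \<sigma> (k - 1))) *
        rat_const (D j $$ (r, c))) +
     rat_const (D N $$ (r, c)))"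

end

theory Submission
  imports Defs
begin

text \<open>Put \<open>u\<^sub>i = \<Prod>\<^bsub>k \<le> i\<^esub> h\<^bsub>k-1\<^esub> / g\<^sub>k\<close>. The block column \<open>(u\<^sub>0 I, \<dots>, u\<^bsub>N-1\<^esub> I)\<close> lies in the kernel of \<open>K\<^sub>N\<close>,
  so its last \<open>N - 1\<close> blocks form \<open>- A\<^sub>N\<inverse> B\<close>, and the transfer function is \<open>M\<^sub>N\<close> times this column,
  which equals \<open>(\<beta>\<^sub>0 g\<^sub>N / \<beta>\<^sub>N) Q\<^sub>N\<close>. The scalar factor vanishes only at \<open>\<xi>\<^sub>N\<close>, hence it can serve as
  \<open>R\<^sub>1\<close>, with \<open>R\<^sub>2 = I\<close> and \<open>s\<^sub>1 = s\<^sub>2 = 0\<close>.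

  Minimality at \<open>x\<close> is immediate if \<open>A\<^sub>N(x)\<close> is nonsingular. Otherwise \<open>x\<close> is one of the poles
  \<open>\<xi>\<^sub>1, \<dots>, \<xi>\<^bsub>N-1\<^esub>\<close>, so no \<open>h\<^sub>j\<close> vanishes at \<open>x\<close>. Then the first \<open>m (N - 1)\<close> columns of \<open>K\<^sub>N(x)\<close> form a
  nonsingular triangular matrix, and every block of a vector in the kernel of \<open>A\<^sub>N(x)\<close> is a multiple
  of its last block \<open>w\<close>; multiplying such a vector by \<open>C(x)\<close> gives \<open>-(h\<^bsub>N-1\<^esub>(x) / \<beta>\<^sub>N) R\<^sub>N(x) w\<close>, so that
  \<open>w = 0\<close> if \<open>C(x)\<close> annihilates it as well.\<close>

section \<open>Rank criteria and block sums\<close>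

text \<open>Two equal columns would put a difference of unit vectors into the kernel. The columns
  are therefore distinct, and a linear dependence of the set of columns is then itself a nonzero
  kernel vector.\<close>

lemma (in vec_space) rank_eq_dim_col_if_injective:
  assumes A: "A \<in> carrier_mat n nc"
    and inj: "\<And>v. v \<in> carrier_vec nc \<Longrightarrow> A *\<^sub>v v = 0\<^sub>v n \<Longrightarrow> v = 0\<^sub>v nc"
  shows "rank A = nc"
proof -
  have dist: "distinct (cols A)"
    unfolding distinct_conv_nth
  proof (intro allI impI)
    fix i j
    assume ij: "i < length (cols A)" "j < length (cols A)" "i \<noteq> j"
    show "cols A ! i \<noteq> cols A ! j"
    proof
      assume eq: "cols A ! i = cols A ! j"
      have lt: "i < nc" "j < nc" using ij A by auto
      have "col A i = col A j" using eq lt A by auto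
      moreover have "A *\<^sub>v unit_vec nc k = col A k" if "k < nc" for k
        using A that by (intro eq_vecI) auto
      ultimately have "A *\<^sub>v (unit_vec nc i - unit_vec nc j) = 0\<^sub>v n"
        using A lt by (simp add: mult_minus_distrib_mat_vec[OF A])
      from inj[OF _ this] have "(unit_vec nc i - unit_vec nc j :: 'a vec) = 0\<^sub>v nc" by simp
      then have "(unit_vec nc i - unit_vec nc j :: 'a vec) $ i = 0" using lt by simp
      then show False using lt ij(3) by simp
    qed
  qed
  have "lin_indpt (set (cols A))"
  proof
    assume "lin_dep (set (cols A))"
    from lin_depE[OF A this dist] inj show False by metis
  qed
  then show ?thesis using lin_indpt_full_rank[OF A dist] by simp
qed

text \<open>The rank depends only on the span of the set of columns, so it suffices to find
  \<open>n\<close> columns, in any order and at any positions, that span the whole space.\<close>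

lemma (in vec_space) rank_eq_dim_row_if_nonsingular_subset:
  assumes M: "M \<in> carrier_mat n nc"
    and H: "H \<in> carrier_mat n n" and det: "det H \<noteq> 0"
    and sub: "set (cols H) \<subseteq> set (cols M)"
  shows "rank M = n"
proof -
  have carrM: "set (cols M) \<subseteq> carrier_vec n" using M cols_dim by blast
  from det_non_zero_imp_unit[OF H det, unfolded Units_def, of "()"]
  obtain B where B: "B \<in> carrier_mat n n" and HB: "H * B = 1\<^sub>m n"
    by (auto simp: ring_mat_def)
  have "\<exists>x\<in>carrier_vec n. H *\<^sub>v x = y" if "y \<in> carrier_vec n" for y
    using that B H HB by (intro bexI[of _ "B *\<^sub>v y"]) (simp_all flip: assoc_mult_mat_vec)
  then have spanH: "span (set (cols H)) = carrier_vec n"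
    using col_space_eq[OF H] H by (auto simp: col_space_def)
  have "span (set (cols H)) \<subseteq> span (set (cols M))"
    using sub by (rule span_is_monotone)
  moreover have "span (set (cols M)) \<subseteq> carrier_vec n"
    using span_closed[OF carrM] by auto
  ultimately have "span (set (cols M)) = span (set (cols H))"
    using spanH by blast
  then have "rank M = rank H" by (simp add: rank_def)
  then show ?thesis using low_rank_det_zero[OF H det] by simp
qed

text \<open>Euclidean division by \<open>m\<close> passes from flat indices to block number and
  position, which is how the recurrences below are indexed.\<close>

lemma sum_blocks:
  fixes f :: "nat \<Rightarrow> 'a::comm_monoid_add"
  shows "(\<Sum>i<m * k. f i) = (\<Sum>j<k. \<Sum>s<m. f (j * m + s))"
proof -
  have "(\<Sum>i<m * k. f i) = (\<Sum>j<k. \<Sum>i=j*m..<j*m+m. f i)"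
    by (simp add: sum.nat_group mult.commute)
  also have "\<dots> = (\<Sum>j<k. \<Sum>s<m. f (j * m + s))"
    by (rule sum.cong[OF refl]) (simp add: sum.atLeastLessThan_shift_0 atLeast0LessThan)
  finally show ?thesis .
qed

section \<open>Values of rational functions\<close>

text \<open>As a definite description, \<open>rat_eval\<close> obeys algebraic laws only away from
  poles. The relation carries the absence of a pole along with the value and is closed under sums
  and products.\<close>

definition has_rat_value :: "'a::field poly fract \<Rightarrow> 'a \<Rightarrow> 'a \<Rightarrow> bool" where
  "has_rat_value f x v \<longleftrightarrow> (\<exists>p q. poly q x \<noteq> 0 \<and> f = Fract p q \<and> v = poly p x / poly q x)"

lemma rat_eval_eq: "has_rat_value f x v \<Longrightarrow> rat_eval f x = v"
  unfolding has_rat_value_def using rat_eval_Fract by blast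

lemma has_rat_value_imp_no_pole: "has_rat_value f x v \<Longrightarrow> \<not> has_pole f x"
  unfolding has_rat_value_def has_pole_def by blast

lemma has_rat_value_to_fract: "has_rat_value (to_fract p) x (poly p x)"
  unfolding has_rat_value_def by (rule exI[of _ p], rule exI[of _ 1]) (simp add: to_fract_def)

lemma has_rat_value_divide:
  "poly q x \<noteq> 0 \<Longrightarrow> has_rat_value (to_fract p / to_fract q) x (poly p x / poly q x)"
  unfolding has_rat_value_def
  by (rule exI[of _ p], rule exI[of _ q]) (simp add: Fract_conv_to_fract)

lemma has_rat_value_add:
  assumes "has_rat_value f x v" "has_rat_value g x w"
  shows "has_rat_value (f + g) x (v + w)"
proof -
  obtain p q p' q' where *: "poly q x \<noteq> 0" "f = Fract p q" "v = poly p x / poly q x"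
    "poly q' x \<noteq> 0" "g = Fract p' q'" "w = poly p' x / poly q' x"
    using assms unfolding has_rat_value_def by blast
  then have "q \<noteq> 0" "q' \<noteq> 0" by auto
  with * show ?thesis unfolding has_rat_value_def
    by (intro exI[of _ "p * q' + p' * q"] exI[of _ "q * q'"]) (simp add: add_frac_eq add.commute mult.commute)
qed

lemma has_rat_value_mult:
  assumes "has_rat_value f x v" "has_rat_value g x w"
  shows "has_rat_value (f * g) x (v * w)"
proof -
  obtain p q p' q' where *: "poly q x \<noteq> 0" "f = Fract p q" "v = poly p x / poly q x"
    "poly q' x \<noteq> 0" "g = Fract p' q'" "w = poly p' x / poly q' x"
    using assms unfolding has_rat_value_def by blast
  then show ?thesis unfolding has_rat_value_def
    by (intro exI[of _ "p * p'"] exI[of _ "q * q'"]) simp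
qed

lemma has_rat_value_sum:
  assumes "\<And>i. i \<in> I \<Longrightarrow> has_rat_value (f i) x (v i)"
  shows "has_rat_value (\<Sum>i\<in>I. f i) x (\<Sum>i\<in>I. v i)"
  using assms
\<comment> \<open>Over an infinite index set the sum is 0 by convention, so that case coincides with
  the empty one.\<close>
proof (induction I rule: infinite_finite_induct)
  case (insert i I)
  then show ?case by (simp add: has_rat_value_add)
qed (use has_rat_value_to_fract[of 0 x] in simp_all)

lemma has_rat_value_prod:
  assumes "\<And>i. i \<in> I \<Longrightarrow> has_rat_value (f i) x (v i)"
  shows "has_rat_value (\<Prod>i\<in>I. f i) x (\<Prod>i\<in>I. v i)"
  using assms
proof (induction I rule: infinite_finite_induct)
  case (insert i I)
  then show ?case by (simp add: has_rat_value_mult)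
qed (use has_rat_value_to_fract[of 1 x] in simp_all)

text \<open>The entries are polynomials, and the determinant takes the value
  \<open>poly p x ^ n\<close> at \<open>x\<close>. Both regular factors in the linearization have
  this form; for the identity, \<open>p = 1\<close>.\<close>

lemma rational_regular_at_scalar:
  assumes "poly p x \<noteq> 0"
  shows "rational_regular_at (to_fract p \<cdot>\<^sub>m 1\<^sub>m n) x"
proof -
  have "has_rat_value (det (to_fract p \<cdot>\<^sub>m 1\<^sub>m n)) x (poly p x ^ n)"
    using has_rat_value_prod[of "{..<n}" "\<lambda>_. to_fract p" x "\<lambda>_. poly p x"]
      has_rat_value_to_fract[of p x] by simp
  moreover have "\<not> has_pole ((to_fract p \<cdot>\<^sub>m 1\<^sub>m n) $$ (i, j)) x" if "i < n" "j < n" for i j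
    using that has_rat_value_imp_no_pole[OF has_rat_value_to_fract[of p x]]
      has_rat_value_imp_no_pole[OF has_rat_value_to_fract[of 0 x]]
    by simp
  ultimately show ?thesis
    using assms by (simp add: rational_regular_at_def rat_eval_eq)
qed

section \<open>Blocks of the pencil\<close>

text \<open>The constant coefficient is \<open>\<beta> i\<close>.\<close>

lemma g_poly_neq_0: "\<beta> i \<noteq> 0 \<Longrightarrow> g_poly \<beta> \<xi> i \<noteq> 0"
  by (cases "\<xi> i") (auto simp: g_poly_def one_pCons)

text \<open>A pole at 0 has to be excluded: since \<open>1 / 0 = 0\<close>, it would make
  \<open>g_poly\<close> a nonzero constant without a zero.\<close>

lemma poly_g_poly_eq_0_iff:
  assumes "\<beta> i \<noteq> 0" "\<xi> i \<noteq> Finite 0"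
  shows "poly (g_poly \<beta> \<xi> i) x = 0 \<longleftrightarrow> \<xi> i = Finite x"
  using assms by (cases "\<xi> i") (auto simp: g_poly_def field_simps)

lemma degree_g_poly: "degree (g_poly \<beta> \<xi> i) \<le> 1"
  unfolding g_poly_def
  by (rule order_trans[OF degree_smult_le], rule degree_diff_le) (cases "\<xi> i"; simp)+

lemma degree_h_poly: "degree (h_poly \<sigma> j) \<le> 1"
  by (simp add: h_poly_def)

section \<open>Entries of the block matrices in flat indices\<close>

lemma dim_K_mat [simp]:
  "dim_row (K_mat \<beta> \<xi> \<sigma> m N) = m * (N - 1)" "dim_col (K_mat \<beta> \<xi> \<sigma> m N) = m * N"
  by (simp_all add: K_mat_def kronecker_def)

lemma dim_M_mat [simp]:
  "dim_row (M_mat \<beta> \<xi> \<sigma> D m N) = m" "dim_col (M_mat \<beta> \<xi> \<sigma> D m N) = m * N"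
  by (simp_all add: M_mat_def)

lemma dim_A_mat [simp]:
  "dim_row (A_mat \<beta> \<xi> \<sigma> m N) = m * (N - 1)" "dim_col (A_mat \<beta> \<xi> \<sigma> m N) = m * (N - 1)"
  by (simp_all add: A_mat_def)

lemma A_mat_carrier: "A_mat \<beta> \<xi> \<sigma> m N \<in> carrier_mat (m * (N - 1)) (m * (N - 1))"
  by (intro carrier_matI) simp_all

text \<open>The identity factor kills every entry whose two positions within their blocks differ.
  What remains is a pair of scalar diagonals at distance \<open>m\<close>, so triangular shapes can
  be read off without blocks.\<close>

lemma K_mat_index:
  assumes "i < m * (N - 1)" "j < m * N"
  shows "K_mat \<beta> \<xi> \<sigma> m N $$ (i, j) =
    (if j = i then - h_poly \<sigma> (i div m)
     else if j = i + m then g_poly \<beta> \<xi> (i div m + 1) else 0)"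
proof -
  have m: "m > 0" using assms by (cases m) auto
  have d: "i div m < N - 1" "j div m < N"
    using assms by (simp_all add: less_mult_imp_div_less mult.commute)
  have e: "j = i \<longleftrightarrow> j div m = i div m \<and> j mod m = i mod m"
    by (metis div_mult_mod_eq)
  have e': "j = i + m \<longleftrightarrow> j div m = i div m + 1 \<and> j mod m = i mod m"
  proof
    assume *: "j div m = i div m + 1 \<and> j mod m = i mod m"
    have "j = j div m * m + j mod m" by simp
    also have "\<dots> = i div m * m + i mod m + m" using * by simp
    finally show "j = i + m" by simp
  qed (use m in simp)
  show ?thesis
    unfolding K_mat_def kronecker_def using assms m d e e'
    by (auto simp: mult.commute)
qed

text \<open>Dropping the first \<open>m\<close> columns moves the upper diagonal of
  \<open>K_mat\<close> onto the main one, so \<open>A_mat\<close> is lower triangular.\<close>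

lemma A_mat_index:
  assumes "i < m * (N - 1)" "j < m * (N - 1)"
  shows "A_mat \<beta> \<xi> \<sigma> m N $$ (i, j) =
    (if j = i then g_poly \<beta> \<xi> (i div m + 1)
     else if j + m = i then - h_poly \<sigma> (i div m) else 0)"
proof -
  have m: "m > 0" using assms by (cases m) auto
  have "j + m < m * N" using assms by (cases N) auto
  then show ?thesis unfolding A_mat_def using assms m by (auto simp: K_mat_index)
qed

lemma M_mat_index:
  assumes "r < m" "j < N" "s < m"
  shows "M_mat \<beta> \<xi> \<sigma> D m N $$ (r, j * m + s) =
    Polynomial.smult (1 / \<beta> N) (g_poly \<beta> \<xi> N) * [:D j $$ (r, s):] +
    (if j = N - 1 then Polynomial.smult (1 / \<beta> N) (h_poly \<sigma> (N - 1)) * [:D N $$ (r, s):] else 0)"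
proof -
  have "j * m + s < (j + 1) * m" using assms by simp
  also have "\<dots> \<le> N * m" using assms by (intro mult_le_mono) auto
  finally have "j * m + s < m * N" by (simp add: mult.commute)
  moreover have "(j * m + s) div m = j" "(j * m + s) mod m = s" using assms by auto
  ultimately show ?thesis unfolding M_mat_def using assms by (simp add: Let_def)
qed

lemma det_A_mat:
  "det (A_mat \<beta> \<xi> \<sigma> m N) = (\<Prod>i<m * (N - 1). g_poly \<beta> \<xi> (i div m + 1))"
proof -
  have "det (A_mat \<beta> \<xi> \<sigma> m N) = prod_list (diag_mat (A_mat \<beta> \<xi> \<sigma> m N))"
    by (rule det_lower_triangular[OF _ A_mat_carrier]) (auto simp: A_mat_index)
  also have "\<dots> = (\<Prod>i<m * (N - 1). A_mat \<beta> \<xi> \<sigma> m N $$ (i, i))"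
    by (simp add: diag_mat_def prod.distinct_set_conv_list[symmetric] atLeast0LessThan flip: atLeast_upt)
  also have "\<dots> = (\<Prod>i<m * (N - 1). g_poly \<beta> \<xi> (i div m + 1))"
    by (intro prod.cong) (auto simp: A_mat_index)
  finally show ?thesis .
qed

text \<open>A row has at most two nonzero entries; rows of the first block have only one, because
  \<open>- h_poly \<sigma> 0\<close> belongs to the columns removed from \<open>K_mat\<close>. The
  map \<open>\<phi>\<close> lets one computation serve both for \<open>to_fract\<close> and for
  evaluation at a point.\<close>

lemma A_mat_row_sum:
  fixes \<phi> :: "'a::field poly \<Rightarrow> 'b::comm_ring_1"
  assumes \<phi>: "\<phi> 0 = 0" "\<And>p. \<phi> (- p) = - \<phi> p" and i: "i < m * (N - 1)"
  shows "(\<Sum>j<m * (N - 1). \<phi> (A_mat \<beta> \<xi> \<sigma> m N $$ (i, j)) * y j) =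
    \<phi> (g_poly \<beta> \<xi> (i div m + 1)) * y i - (if m \<le> i then \<phi> (h_poly \<sigma> (i div m)) * y (i - m) else 0)"
proof -
  have m: "m > 0" using i by (cases m) auto
  have "(\<Sum>j<m * (N - 1). \<phi> (A_mat \<beta> \<xi> \<sigma> m N $$ (i, j)) * y j) =
    (\<Sum>j<m * (N - 1). (if j = i then \<phi> (g_poly \<beta> \<xi> (i div m + 1)) * y i else 0) -
       (if m \<le> i \<and> j = i - m then \<phi> (h_poly \<sigma> (i div m)) * y (i - m) else 0))"
    using i m by (intro sum.cong) (auto simp: A_mat_index \<phi>)
  also have "\<dots> = \<phi> (g_poly \<beta> \<xi> (i div m + 1)) * y i -
      (if m \<le> i then \<phi> (h_poly \<sigma> (i div m)) * y (i - m) else 0)"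
    using i less_imp_diff_less[OF i, of m]
    by (cases "m \<le> i") (simp_all add: sum_subtractf)
  finally show ?thesis .
qed

section \<open>Partition of the pencil as a linear polynomial system matrix\<close>

definition D_mat ::
    "(nat \<Rightarrow> 'a::field) \<Rightarrow> (nat \<Rightarrow> 'a ext_point) \<Rightarrow> (nat \<Rightarrow> 'a) \<Rightarrow> (nat \<Rightarrow> 'a mat) \<Rightarrow>
     nat \<Rightarrow> nat \<Rightarrow> 'a poly mat" where
  "D_mat \<beta> \<xi> \<sigma> D m N = mat m m (\<lambda>(r, c). M_mat \<beta> \<xi> \<sigma> D m N $$ (r, c))"

text \<open>The sign compensates the block \<open>- C\<close> in
  \<open>polynomial_system_matrix\<close>.\<close>

definition C_mat ::
    "(nat \<Rightarrow> 'a::field) \<Rightarrow> (nat \<Rightarrow> 'a ext_point) \<Rightarrow> (nat \<Rightarrow> 'a) \<Rightarrow> (nat \<Rightarrow> 'a mat) \<Rightarrow>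
     nat \<Rightarrow> nat \<Rightarrow> 'a poly mat" where
  "C_mat \<beta> \<xi> \<sigma> D m N = mat m (m * (N - 1)) (\<lambda>(r, j). - M_mat \<beta> \<xi> \<sigma> D m N $$ (r, j + m))"

definition B_mat ::
    "(nat \<Rightarrow> 'a::field) \<Rightarrow> (nat \<Rightarrow> 'a ext_point) \<Rightarrow> (nat \<Rightarrow> 'a) \<Rightarrow> nat \<Rightarrow> nat \<Rightarrow> 'a poly mat" where
  "B_mat \<beta> \<xi> \<sigma> m N = mat (m * (N - 1)) m (\<lambda>(i, c). K_mat \<beta> \<xi> \<sigma> m N $$ (i, c))"

lemma dim_blocks [simp]:
  "dim_row (D_mat \<beta> \<xi> \<sigma> D m N) = m" "dim_col (D_mat \<beta> \<xi> \<sigma> D m N) = m"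
  "dim_row (C_mat \<beta> \<xi> \<sigma> D m N) = m" "dim_col (C_mat \<beta> \<xi> \<sigma> D m N) = m * (N - 1)"
  "dim_row (B_mat \<beta> \<xi> \<sigma> m N) = m * (N - 1)" "dim_col (B_mat \<beta> \<xi> \<sigma> m N) = m"
  by (simp_all add: D_mat_def C_mat_def B_mat_def)

lemma block_carriers:
  "D_mat \<beta> \<xi> \<sigma> D m N \<in> carrier_mat m m"
  "C_mat \<beta> \<xi> \<sigma> D m N \<in> carrier_mat m (m * (N - 1))"
  "B_mat \<beta> \<xi> \<sigma> m N \<in> carrier_mat (m * (N - 1)) m"
  by (intro carrier_matI; simp)+

lemma B_mat_index:
  assumes "N \<ge> 2" "i < m * (N - 1)" "c < m"
  shows "B_mat \<beta> \<xi> \<sigma> m N $$ (i, c) = (if i = c then - h_poly \<sigma> 0 else 0)"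
proof -
  have "m * 1 \<le> m * N" using assms by (intro mult_le_mono2) simp
  with \<open>c < m\<close> have "c < m * N" by linarith
  then show ?thesis unfolding B_mat_def using assms by (auto simp: K_mat_index)
qed

lemma polynomial_system_matrix_L_mat:
  assumes N: "N \<ge> 2" and \<beta>: "\<And>i. i \<le> N \<Longrightarrow> \<beta> i \<noteq> 0"
  shows "polynomial_system_matrix (L_mat \<beta> \<xi> \<sigma> D m N)
    (D_mat \<beta> \<xi> \<sigma> D m N) (C_mat \<beta> \<xi> \<sigma> D m N) (B_mat \<beta> \<xi> \<sigma> m N) (A_mat \<beta> \<xi> \<sigma> m N)"
proof -
  have "m * N = m + m * (N - 1)" using N by (cases N) auto
  then have L: "L_mat \<beta> \<xi> \<sigma> D m N =
      four_block_mat (D_mat \<beta> \<xi> \<sigma> D m N) (- C_mat \<beta> \<xi> \<sigma> D m N) (B_mat \<beta> \<xi> \<sigma> m N) (A_mat \<beta> \<xi> \<sigma> m N)"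
    unfolding L_mat_def append_rows_def
    by (intro eq_matI) (auto simp: D_mat_def C_mat_def B_mat_def A_mat_def)
  have "g_poly \<beta> \<xi> (i div m + 1) \<noteq> 0" if "i < m * (N - 1)" for i
  proof -
    have "i div m < N - 1" using that by (simp add: less_mult_imp_div_less mult.commute)
    then show ?thesis by (intro g_poly_neq_0 \<beta>) simp
  qed
  then have det: "det (A_mat \<beta> \<xi> \<sigma> m N) \<noteq> 0" by (auto simp: det_A_mat)
  show ?thesis
    unfolding polynomial_system_matrix_def
    by (intro conjI, rule exI[of _ "m * (N - 1)"], rule exI[of _ m], rule exI[of _ m])
      (simp_all only: L det block_carriers A_mat_carrier simp_thms not_False_eq_True)
qed

lemma linear_L_mat: "linear_poly_mat (L_mat \<beta> \<xi> \<sigma> D m N)"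
proof -
  have "degree (M_mat \<beta> \<xi> \<sigma> D m N $$ (r, c)) \<le> 1" if "r < m" "c < m * N" for r c
    using that degree_g_poly[of \<beta> \<xi> N] degree_h_poly[of \<sigma> "N - 1"]
    unfolding M_mat_def Let_def
    by (auto intro!: degree_add_le order_trans[OF degree_smult_le] simp: mult.commute[of _ "[:_:]"])
  moreover have "degree (K_mat \<beta> \<xi> \<sigma> m N $$ (i, j)) \<le> 1" if "i < m * (N - 1)" "j < m * N" for i j
    using that degree_g_poly[of \<beta> \<xi> "i div m + 1"] degree_h_poly[of \<sigma> "i div m"]
    by (simp add: K_mat_index)
  ultimately show ?thesis
    unfolding linear_poly_mat_def L_mat_def append_rows_def by auto
qed

section \<open>The transfer function\<close>

text \<open>A nonzero determinant makes \<open>mat_inverse\<close> return \<open>Some\<close>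
  inverse, and any solution of \<open>A X = B\<close> over the rational functions must equal this
  inverse times \<open>B\<close>. No explicit inverse is then required.\<close>

lemma transfer_function_eq:
  assumes c: "D \<in> carrier_mat q t" "C \<in> carrier_mat q n" "B \<in> carrier_mat n t" "A \<in> carrier_mat n n"
    and det: "det A \<noteq> 0"
    and X: "X \<in> carrier_mat n t" and AX: "map_mat to_fract A * X = map_mat to_fract B"
  shows "transfer_function D C B A = map_mat to_fract D + map_mat to_fract C * X"
proof -
  let ?A = "map_mat to_fract A"
  have A: "?A \<in> carrier_mat n n" using c by simp
  interpret to_fract: comm_ring_hom "to_fract :: 'a poly \<Rightarrow> _" by unfold_locales auto
  have "det ?A \<noteq> 0" using det by (simp add: to_fract.hom_det)
  from det_non_zero_imp_unit[OF A this, of "()"] mat_inverse(1)[OF A, where b="()"]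
  obtain Y where Y: "mat_inverse ?A = Some Y" by (cases "mat_inverse ?A") auto
  from mat_inverse(2)[OF A this] have Yc: "Y \<in> carrier_mat n n" and YA: "Y * ?A = 1\<^sub>m n" by auto
  have "Y * map_mat to_fract B = X"
    using X A Yc YA by (simp flip: AX assoc_mult_mat[OF Yc A X])
  moreover have "map_mat to_fract C * Y * map_mat to_fract B
      = map_mat to_fract C * (Y * map_mat to_fract B)"
    using c Yc by (intro assoc_mult_mat) auto
  ultimately show ?thesis unfolding transfer_function_def by (simp add: Y)
qed

lemma transfer_function_L_mat:
  fixes \<sigma> \<beta> :: "nat \<Rightarrow> 'a::field"
  assumes N: "N \<ge> 2" and \<beta>: "\<And>i. i \<le> N \<Longrightarrow> \<beta> i \<noteq> 0"
  shows "transfer_function (D_mat \<beta> \<xi> \<sigma> D m N) (C_mat \<beta> \<xi> \<sigma> D m N) (B_mat \<beta> \<xi> \<sigma> m N) (A_mat \<beta> \<xi> \<sigma> m N)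
    = to_fract (Polynomial.smult (\<beta> 0 / \<beta> N) (g_poly \<beta> \<xi> N)) \<cdot>\<^sub>m Q_mat \<beta> \<xi> \<sigma> D m N"
    (is "?T = ?rhs")
proof -
  let ?n = "m * (N - 1)"
  define g where "g k = to_fract (g_poly \<beta> \<xi> k)" for k
  define h where "h k = to_fract (h_poly \<sigma> k)" for k
  define u where "u j = (\<Prod>k=1..j. h (k - 1) / g k)" for j
  have g0: "g k \<noteq> 0" if "k \<le> N" for k
    using g_poly_neq_0[of \<beta> k, OF \<beta>[OF that]] by (simp add: g_def)
  have u_Suc: "g (Suc j) * u (Suc j) = h j * u j" if "j < N" for j
    using g0[of "Suc j"] that by (simp add: u_def)
  \<comment> \<open>Column \<open>c\<close> of the solution. The kernel column starts with
    \<open>u 0 = 1\<close>, which multiplies \<open>B_mat\<close>; hence the shift by one in the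
    block number, and the sign from moving that term to the other side.\<close>
  define y where "y c i = (if i mod m = c then - u (i div m + 1) else 0)" for c i
  \<comment> \<open>\<open>X\<close> is \<open>A\<inverse> B\<close>.\<close>
  define X where "X = mat ?n m (\<lambda>(i, c). y c i)"
  have X: "X \<in> carrier_mat ?n m" by (simp add: X_def)
  have AX: "map_mat to_fract (A_mat \<beta> \<xi> \<sigma> m N) * X = map_mat to_fract (B_mat \<beta> \<xi> \<sigma> m N)"
  proof (rule eq_matI)
    fix i c
    assume "i < dim_row (map_mat to_fract (B_mat \<beta> \<xi> \<sigma> m N))"
      "c < dim_col (map_mat to_fract (B_mat \<beta> \<xi> \<sigma> m N))"
    then have ic: "i < ?n" "c < m" by simp_all
    have "i div m < N - 1" using ic by (simp add: less_mult_imp_div_less mult.commute)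
    then have q: "i div m < N" by simp
    have "(map_mat to_fract (A_mat \<beta> \<xi> \<sigma> m N) * X) $$ (i, c) =
        (\<Sum>j<?n. to_fract (A_mat \<beta> \<xi> \<sigma> m N $$ (i, j)) * y c j)"
      using ic by (simp add: scalar_prod_def X_def atLeast0LessThan)
    also have "\<dots> = g (i div m + 1) * y c i - (if m \<le> i then h (i div m) * y c (i - m) else 0)"
      using ic by (subst A_mat_row_sum) (simp_all add: g_def h_def)
    also have "\<dots> = to_fract (B_mat \<beta> \<xi> \<sigma> m N $$ (i, c))"
    \<comment> \<open>Below the first block row the recurrence for \<open>u\<close> cancels the two
      terms, matching the zeros of \<open>B_mat\<close>. In the first block row
      \<open>u 0 = 1\<close> leaves \<open>- h 0\<close> on the diagonal.\<close>
    proof (cases "m \<le> i")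
      case True
      have "(i - m) div m + 1 = i div m" "(i - m) mod m = i mod m"
        using True ic by (simp_all add: le_div_geq le_mod_geq)
      then have "g (i div m + 1) * y c i = h (i div m) * y c (i - m)"
        using u_Suc[OF q] by (simp add: y_def)
      then show ?thesis using True ic N by (simp add: B_mat_index)
    next
      case False
      then have "g (i div m + 1) * y c i = (if i = c then - h 0 else 0)"
        using u_Suc[of 0] N by (simp add: y_def u_def)
      then show ?thesis using False ic N by (simp add: B_mat_index h_def)
    qed
    finally show "(map_mat to_fract (A_mat \<beta> \<xi> \<sigma> m N) * X) $$ (i, c) =
        map_mat to_fract (B_mat \<beta> \<xi> \<sigma> m N) $$ (i, c)"
      using ic by simp
  qed (simp_all add: X_def)
  have "det (A_mat \<beta> \<xi> \<sigma> m N) \<noteq> 0"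
    using polynomial_system_matrix_L_mat[of N \<beta>, OF N \<beta>] by (simp add: polynomial_system_matrix_def)
  then have T: "?T = map_mat to_fract (D_mat \<beta> \<xi> \<sigma> D m N) + map_mat to_fract (C_mat \<beta> \<xi> \<sigma> D m N) * X"
    using block_carriers A_mat_carrier by (intro transfer_function_eq[OF _ _ _ _ _ X AX])
  have entry: "to_fract (D_mat \<beta> \<xi> \<sigma> D m N $$ (r, c)) + (\<Sum>i<?n. to_fract (C_mat \<beta> \<xi> \<sigma> D m N $$ (r, i)) * y c i)
      = to_fract (Polynomial.smult (\<beta> 0 / \<beta> N) (g_poly \<beta> \<xi> N)) * Q_mat \<beta> \<xi> \<sigma> D m N $$ (r, c)"
    (is "?l = ?r") if rc: "r < m" "c < m" for r c
  proof -
    let ?M = "\<lambda>j. to_fract (M_mat \<beta> \<xi> \<sigma> D m N $$ (r, j * m + c))"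
    let ?d = "\<lambda>j. rat_const (D j $$ (r, c))"
    have sm: "to_fract (Polynomial.smult a p) = rat_const a * to_fract p" for a and p :: "'a poly"
      by (simp flip: to_fract_mult)
    obtain N' where N': "N = Suc N'" using N by (cases N) auto
    have "(\<Sum>i<?n. to_fract (C_mat \<beta> \<xi> \<sigma> D m N $$ (r, i)) * y c i)
        = (\<Sum>i<?n. if i mod m = c then to_fract (M_mat \<beta> \<xi> \<sigma> D m N $$ (r, i + m)) * u (i div m + 1) else 0)"
      using rc by (intro sum.cong) (auto simp: C_mat_def y_def)
    also have "\<dots> = (\<Sum>j<N - 1. \<Sum>s<m. if s = c then ?M (j + 1) * u (j + 1) else 0)"
      unfolding sum_blocks by (intro sum.cong) (auto simp: algebra_simps)
    also have "\<dots> = (\<Sum>j<N - 1. ?M (j + 1) * u (j + 1))"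
      using rc by simp
    \<comment> \<open>\<open>D_mat\<close> supplies the term \<open>j = 0\<close>, again because
      \<open>u 0 = 1\<close>; the signs of \<open>C_mat\<close> and \<open>y\<close> have
      cancelled.\<close>
    finally have "?l = (\<Sum>j<N. ?M j * u j)"
      using rc by (simp add: N' sum.lessThan_Suc_shift D_mat_def u_def del: sum.lessThan_Suc)
    also have "\<dots> = (\<Sum>j<N. rat_const (1 / \<beta> N) * g N * ?d j * u j
        + (if j = N - 1 then rat_const (1 / \<beta> N) * h (N - 1) * ?d N * u j else 0))"
    proof (intro sum.cong refl)
      fix j assume "j \<in> {..<N}"
      then have "?M j = rat_const (1 / \<beta> N) * g N * ?d j
          + (if j = N - 1 then rat_const (1 / \<beta> N) * h (N - 1) * ?d N else 0)"
        using rc by (subst M_mat_index) (auto simp: g_def h_def sm simp del: mult_pCons_right)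
      then show "?M j * u j = rat_const (1 / \<beta> N) * g N * ?d j * u j
          + (if j = N - 1 then rat_const (1 / \<beta> N) * h (N - 1) * ?d N * u j else 0)"
        by (simp add: distrib_right)
    qed
    also have "\<dots> = (\<Sum>j<N. rat_const (1 / \<beta> N) * g N * ?d j * u j)
        + rat_const (1 / \<beta> N) * ?d N * (h (N - 1) * u (N - 1))"
      using N by (simp add: sum.distrib)
    \<comment> \<open>This converts the extra summand in the last block of \<open>M_mat\<close> into
      the missing term \<open>j = N\<close>, with the same factor \<open>g N\<close> as all the
      others.\<close>
    also have "h (N - 1) * u (N - 1) = g N * u N"
      using u_Suc[of "N - 1"] N by simp
    also have "(\<Sum>j<N. rat_const (1 / \<beta> N) * g N * ?d j * u j) + rat_const (1 / \<beta> N) * ?d N * (g N * u N)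
       = (\<Sum>j=0..N. rat_const (1 / \<beta> N) * g N * ?d j * u j)"
      by (simp add: atLeast0AtMost flip: lessThan_Suc_atMost)
    also have "\<dots> = ?r"
    proof -
      have "rat_const (1 / \<beta> N) = rat_const (\<beta> 0 / \<beta> N) * rat_const (1 / \<beta> 0)"
        using \<beta>[of 0] by (simp flip: to_fract_mult)
      moreover have "b_fun \<beta> \<xi> \<sigma> j = rat_const (1 / \<beta> 0) * u j" for j
        by (simp add: b_fun_def u_def g_def h_def)
      ultimately show ?thesis
        using rc by (simp add: Q_mat_def sm g_def sum_distrib_left mult_ac)
    qed
    finally show ?thesis .
  qed
  show ?thesis
  proof (rule eq_matI)
    fix r c
    assume "r < dim_row ?rhs" "c < dim_col ?rhs"
    then have rc: "r < m" "c < m" by (simp_all add: Q_mat_def)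
    have "?T $$ (r, c) = to_fract (D_mat \<beta> \<xi> \<sigma> D m N $$ (r, c))
        + (\<Sum>i<?n. to_fract (C_mat \<beta> \<xi> \<sigma> D m N $$ (r, i)) * y c i)"
      using rc unfolding T by (simp add: scalar_prod_def X_def atLeast0LessThan)
    then show "?T $$ (r, c) = ?rhs $$ (r, c)"
      using rc entry[OF rc] by (simp add: Q_mat_def)
  qed (simp_all add: T X_def Q_mat_def)
qed

section \<open>Minimality\<close>

lemma det_A_mat_eval:
  "det (poly_mat_eval (A_mat \<beta> \<xi> \<sigma> m N) x) = (\<Prod>i<m * (N - 1). poly (g_poly \<beta> \<xi> (i div m + 1)) x)"
proof -
  interpret ev: comm_ring_hom "\<lambda>p. poly p x" by unfold_locales auto
  show ?thesis by (simp add: ev.hom_det det_A_mat poly_prod)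
qed

text \<open>The columns are those of \<open>K_mat\<close> at \<open>x\<close>, with the first block
  moved to the end. The columns of \<open>A_mat\<close> form a nonsingular matrix if no
  \<open>g_poly\<close> vanishes; if no \<open>h_poly\<close> vanishes, the leading columns of
  \<open>K_mat\<close> do, being upper triangular with entries \<open>- h_poly\<close> on the
  diagonal.\<close>

lemma row_rank_system:
  fixes \<sigma> \<beta> :: "nat \<Rightarrow> 'a::field"
  assumes N: "N \<ge> 2"
    and disj: "(\<forall>k\<in>{1..N - 1}. poly (g_poly \<beta> \<xi> k) x \<noteq> 0) \<or> (\<forall>j<N - 1. poly (h_poly \<sigma> j) x \<noteq> 0)"
  shows "vec_space.rank (m * (N - 1)) (poly_mat_eval (four_block_mat (A_mat \<beta> \<xi> \<sigma> m N) (B_mat \<beta> \<xi> \<sigma> m N)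
      (0\<^sub>m 0 (m * (N - 1))) (0\<^sub>m 0 m)) x) = m * (N - 1)"
    (is "vec_space.rank ?n ?AB = ?n")
proof -
  interpret vec_space "TYPE('a)" ?n .
  have mN: "m * N = m + ?n" using N by (cases N) auto
  have AB: "?AB \<in> carrier_mat ?n (?n + m)"
    by (intro carrier_matI) simp_all
  define K where "K j = vec ?n (\<lambda>i. poly (K_mat \<beta> \<xi> \<sigma> m N $$ (i, j)) x)" for j
  have colAB: "col ?AB j = K (if j < ?n then j + m else j - ?n)" if "j < ?n + m" for j
    using that AB by (intro eq_vecI) (auto simp: K_def A_mat_def B_mat_def)
  have K_in: "K j \<in> set (cols ?AB)" if "j < m + ?n" for j
  proof -
    \<comment> \<open>The place of column \<open>j\<close> of \<open>K_mat\<close> after that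
      rearrangement.\<close>
    define j' where "j' = (if j < m then j + ?n else j - m)"
    have j': "j' < ?n + m" using that by (auto simp: j'_def)
    have "K j = col ?AB j'"
    proof (cases "j < m")
      case False
      with that have "j - m < ?n" by linarith
      then show ?thesis using False colAB[OF j'] by (simp add: j'_def)
    qed (use colAB[OF j'] in \<open>simp add: j'_def\<close>)
    with j' show ?thesis using AB by (metis carrier_matD(2) cols_length cols_nth nth_mem)
  qed
  have div: "i div m < N - 1" if "i < ?n" for i
    using that by (simp add: less_mult_imp_div_less mult.commute)
  show ?thesis
  proof (cases "\<forall>k\<in>{1..N - 1}. poly (g_poly \<beta> \<xi> k) x \<noteq> 0")
    case True
    let ?H = "poly_mat_eval (A_mat \<beta> \<xi> \<sigma> m N) x"
    have H: "?H \<in> carrier_mat ?n ?n" by (intro carrier_matI) simp_all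
    have "det ?H \<noteq> 0"
      unfolding det_A_mat_eval using True div by fastforce
    moreover have "set (cols ?H) \<subseteq> set (cols ?AB)"
    proof
      fix v assume "v \<in> set (cols ?H)"
      then obtain j where j: "j < ?n" "v = col ?H j"
        using H by (metis carrier_matD(2) cols_length cols_nth in_set_conv_nth)
      then have "v = K (j + m)" using H by (intro eq_vecI) (auto simp: K_def A_mat_def)
      then show "v \<in> set (cols ?AB)" using K_in j by simp
    qed
    ultimately show ?thesis by (rule rank_eq_dim_row_if_nonsingular_subset[OF AB H])
  next
    case False
    with disj have h: "poly (h_poly \<sigma> j) x \<noteq> 0" if "j < N - 1" for j using that by blast
    define H where "H = mat ?n ?n (\<lambda>(i, j). poly (K_mat \<beta> \<xi> \<sigma> m N $$ (i, j)) x)"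
    have H: "H \<in> carrier_mat ?n ?n" by (simp add: H_def)
    have "upper_triangular H"
      by (auto simp: H_def K_mat_index mN)
    moreover have "H $$ (i, i) \<noteq> 0" if "i < ?n" for i
      using that h[OF div[OF that]] by (simp add: H_def K_mat_index mN)
    then have "0 \<notin> set (diag_mat H)"
      using H by (auto simp: diag_mat_def)
    ultimately have "det H \<noteq> 0"
      using det_upper_triangular[OF _ H] by (simp add: prod_list_zero_iff)
    moreover have "set (cols H) \<subseteq> set (cols ?AB)"
    proof
      fix v assume "v \<in> set (cols H)"
      then obtain j where j: "j < ?n" "v = col H j"
        using H by (metis carrier_matD(2) cols_length cols_nth in_set_conv_nth)
      then have "v = K j" using H by (intro eq_vecI) (auto simp: K_def H_def)
      then show "v \<in> set (cols ?AB)" using K_in j by simp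
    qed
    ultimately show ?thesis by (rule rank_eq_dim_row_if_nonsingular_subset[OF AB H])
  qed
qed

section \<open>Trivial common kernel of the state and output blocks\<close>

lemma rat_eval_R_mat:
  assumes h: "\<And>j. j < N \<Longrightarrow> poly (h_poly \<sigma> j) x \<noteq> 0" and rs: "r < m" "s < m"
  shows "rat_mat_eval (R_mat \<beta> \<xi> \<sigma> D m N) x $$ (r, s) =
    (\<Sum>j=1..N - 1. (\<Prod>k=j+1..N. poly (g_poly \<beta> \<xi> k) x / poly (h_poly \<sigma> (k - 1)) x) * D j $$ (r, s))
      + D N $$ (r, s)"
proof -
  have const: "has_rat_value (rat_const a) x a" for a
    using has_rat_value_to_fract[of "[:a:]" x] by simp
  have "has_rat_value (R_mat \<beta> \<xi> \<sigma> D m N $$ (r, s)) x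
    ((\<Sum>j=1..N - 1. (\<Prod>k=j+1..N. poly (g_poly \<beta> \<xi> k) x / poly (h_poly \<sigma> (k - 1)) x) * D j $$ (r, s))
      + D N $$ (r, s))"
    using rs unfolding R_mat_def
    by (auto intro!: has_rat_value_add has_rat_value_sum has_rat_value_mult has_rat_value_prod
        has_rat_value_divide const h)
  then show ?thesis using rs by (simp add: rat_eval_eq R_mat_def)
qed

lemma invertible_mat_kernel_trivial:
  assumes "invertible_mat A" "A \<in> carrier_mat n n" "v \<in> carrier_vec n" "A *\<^sub>v v = 0\<^sub>v n"
  shows "v = 0\<^sub>v n"
proof -
  obtain B where AB: "A * B = 1\<^sub>m n" and BA: "B * A = 1\<^sub>m (dim_row B)"
    using assms(1,2) by (auto simp: invertible_mat_def inverts_mat_def)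
  \<comment> \<open>\<open>inverts_mat\<close> leaves the shape of \<open>B\<close> open; both
    dimensions come from comparing column counts in the two products.\<close>
  have B: "B \<in> carrier_mat n n"
    using assms(2) arg_cong[OF AB, of dim_col] arg_cong[OF BA, of dim_col] by auto
  have "v = B * A *\<^sub>v v" using BA B assms(3) by simp
  also have "\<dots> = B *\<^sub>v (A *\<^sub>v v)" using B assms(2,3) by simp
  also have "\<dots> = 0\<^sub>v n" using B assms(4) by (intro eq_vecI) auto
  finally show ?thesis .
qed

lemma kernel_system_trivial:
  fixes \<sigma> \<beta> :: "nat \<Rightarrow> 'a::field"
  assumes N: "N \<ge> 2" and \<beta>: "\<beta> N \<noteq> 0"
    and h: "\<And>j. j < N \<Longrightarrow> poly (h_poly \<sigma> j) x \<noteq> 0"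
    and R: "invertible_mat (rat_mat_eval (R_mat \<beta> \<xi> \<sigma> D m N) x)"
    and v: "v \<in> carrier_vec (m * (N - 1))"
    and Av: "poly_mat_eval (A_mat \<beta> \<xi> \<sigma> m N) x *\<^sub>v v = 0\<^sub>v (m * (N - 1))"
    and Cv: "poly_mat_eval (C_mat \<beta> \<xi> \<sigma> D m N) x *\<^sub>v v = 0\<^sub>v m"
  shows "v = 0\<^sub>v (m * (N - 1))"
proof -
  let ?n = "m * (N - 1)"
  define g where "g k = poly (g_poly \<beta> \<xi> k) x" for k
  define \<eta> where "\<eta> k = poly (h_poly \<sigma> k) x" for k
  have \<eta>0: "\<eta> k \<noteq> 0" if "k < N" for k using h[OF that] by (simp add: \<eta>_def)
  \<comment> \<open>Block \<open>j\<close> of \<open>v\<close>, counted from 1, is \<open>W j\<close> times the last block \<open>w\<close>.\<close>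
  define W where "W j = (\<Prod>k=j+1..N - 1. g k / \<eta> (k - 1))" for j
  have blk: "j * m + s < ?n" if "j < N - 1" "s < m" for j s
  proof -
    have "j * m + s < (j + 1) * m" using that by simp
    also have "\<dots> \<le> (N - 1) * m" using that by (intro mult_le_mono1) simp
    finally show ?thesis by (simp add: mult.commute)
  qed
  \<comment> \<open>Block row \<open>j + 1\<close> of the kernel equation, solved for the earlier
    block: this divides only by a value of \<open>h_poly\<close>, whereas \<open>g\<close> may
    vanish at \<open>x\<close>.\<close>
  have rec: "v $ (j * m + s) = g (j + 2) / \<eta> (j + 1) * v $ (Suc j * m + s)"
    if j: "Suc j < N - 1" and s: "s < m" for j s
  proof -
    let ?i = "Suc j * m + s"
    have i: "?i < ?n" using blk[OF j s] .
    have "(\<Sum>l<?n. poly (A_mat \<beta> \<xi> \<sigma> m N $$ (?i, l)) x * v $ l) = (poly_mat_eval (A_mat \<beta> \<xi> \<sigma> m N) x *\<^sub>v v) $ ?i"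
      using i v
      by (simp add: scalar_prod_def atLeast0LessThan)
    also have "\<dots> = 0" using i by (simp add: Av)
    finally have "poly (g_poly \<beta> \<xi> (?i div m + 1)) x * v $ ?i
        - (if m \<le> ?i then poly (h_poly \<sigma> (?i div m)) x * v $ (?i - m) else 0) = 0"
      using A_mat_row_sum[OF _ _ i, of "\<lambda>p. poly p x" \<beta> \<xi> \<sigma> "\<lambda>l. v $ l"] by simp
    moreover have "?i div m = j + 1" using s by (subst div_mult_self3) auto
    moreover have "m \<le> ?i" "?i - m = j * m + s" by auto
    ultimately have "g (j + 2) * v $ ?i = \<eta> (j + 1) * v $ (j * m + s)"
      by (simp add: g_def \<eta>_def)
    then show ?thesis using \<eta>0[of "j + 1"] j by (simp add: field_simps)
  qed
  define w where "w = vec m (\<lambda>s. v $ ((N - 2) * m + s))"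
  \<comment> \<open>Downward induction from the last block, number \<open>N - 2\<close> when
    counting from 0, where \<open>W (N - 1)\<close> is an empty product.\<close>
  have vW: "v $ (j * m + s) = W (j + 1) * w $ s" if "j \<le> N - 2" "s < m" for j s
    using that(1)
  proof (induction rule: inc_induct)
    case base
    then show ?case using that N by (simp add: W_def w_def)
  next
    case (step j)
    have "{j + 2..N - 1} = insert (j + 2) {j + 3..N - 1}" using step by auto
    then have "W (j + 1) = g (j + 2) / \<eta> (j + 1) * W (j + 2)"
      by (simp add: W_def numeral_eq_Suc)
    then show ?case using step rec[of j s] that by simp
  qed
  \<comment> \<open>Chosen so that \<open>g N / \<beta> N\<close> is \<open>?c\<close> times
    \<open>g N / \<eta> (N - 1)\<close>: the latter completes \<open>W j\<close> to the product in
    \<open>R_mat\<close>, and \<open>D N\<close> is left with coefficient 1.\<close>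
  let ?c = "\<eta> (N - 1) / \<beta> N"
  have c0: "?c \<noteq> 0" using \<eta>0[of "N - 1"] \<beta> N by simp
  have Rw: "rat_mat_eval (R_mat \<beta> \<xi> \<sigma> D m N) x *\<^sub>v w = 0\<^sub>v m"
  proof (rule eq_vecI)
    fix r assume "r < dim_vec (0\<^sub>v m :: 'a vec)"
    then have r: "r < m" by simp
    let ?M = "\<lambda>l. poly (M_mat \<beta> \<xi> \<sigma> D m N $$ (r, l)) x"
    have coeff: "(\<Sum>j<N - 1. ?M ((j + 1) * m + s) * W (j + 1))
        = ?c * rat_mat_eval (R_mat \<beta> \<xi> \<sigma> D m N) x $$ (r, s)" if s: "s < m" for s
    proof -
      have "(\<Sum>j<N - 1. ?M ((j + 1) * m + s) * W (j + 1)) = (\<Sum>j=1..N - 1. ?M (j * m + s) * W j)"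
        by (rule sum.reindex_bij_witness[of _ "\<lambda>j. j - 1" "\<lambda>j. j + 1"]) auto
      also have "\<dots> = (\<Sum>j=1..N - 1. g N / \<beta> N * D j $$ (r, s) * W j
          + (if j = N - 1 then ?c * D N $$ (r, s) * W j else 0))"
      proof (intro sum.cong refl)
        fix j assume "j \<in> {1..N - 1}"
        then have "?M (j * m + s) = g N / \<beta> N * D j $$ (r, s)
            + (if j = N - 1 then ?c * D N $$ (r, s) else 0)"
          using r s N by (subst M_mat_index) (auto simp: g_def \<eta>_def mult.commute)
        then show "?M (j * m + s) * W j = g N / \<beta> N * D j $$ (r, s) * W j
            + (if j = N - 1 then ?c * D N $$ (r, s) * W j else 0)"
          by (simp add: distrib_right)
      qed
      also have "\<dots> = (\<Sum>j=1..N - 1. g N / \<beta> N * D j $$ (r, s) * W j) + ?c * D N $$ (r, s)"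
        using N by (simp add: sum.distrib W_def)
      also have "(\<Sum>j=1..N - 1. g N / \<beta> N * D j $$ (r, s) * W j)
          = (\<Sum>j=1..N - 1. ?c * ((\<Prod>k=j+1..N. g k / \<eta> (k - 1)) * D j $$ (r, s)))"
      proof (intro sum.cong refl)
        fix j assume j: "j \<in> {1..N - 1}"
        have "{j + 1..N} = insert N {j + 1..N - 1}" "N \<notin> {j + 1..N - 1}"
          using j N by auto
        then have "(\<Prod>k=j+1..N. g k / \<eta> (k - 1)) = g N / \<eta> (N - 1) * W j"
          by (simp add: W_def del: atLeastAtMost_iff)
        then show "g N / \<beta> N * D j $$ (r, s) * W j
            = ?c * ((\<Prod>k=j+1..N. g k / \<eta> (k - 1)) * D j $$ (r, s))"
          using \<eta>0[of "N - 1"] N by simp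
      qed
      finally show ?thesis
        using rat_eval_R_mat[OF h r s, where D = D and \<beta> = \<beta> and \<xi> = \<xi>]
        by (simp add: g_def \<eta>_def sum_distrib_left distrib_left)
    qed
    \<comment> \<open>The sign turns the row of \<open>C_mat\<close> into one of
      \<open>M_mat\<close>; grouping by blocks and exchanging the sums then isolates the coefficient
      of each \<open>w $ s\<close>.\<close>
    have "0 = - (poly_mat_eval (C_mat \<beta> \<xi> \<sigma> D m N) x *\<^sub>v v) $ r" using r by (simp add: Cv)
    also have "\<dots> = (\<Sum>i<?n. ?M (i + m) * v $ i)"
      using r v by (simp add: scalar_prod_def atLeast0LessThan C_mat_def sum_negf)
    also have "\<dots> = (\<Sum>j<N - 1. \<Sum>s<m. ?M ((j + 1) * m + s) * (W (j + 1) * w $ s))"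
      unfolding sum_blocks using vW by (intro sum.cong refl) (auto simp: algebra_simps)
    also have "\<dots> = (\<Sum>s<m. (\<Sum>j<N - 1. ?M ((j + 1) * m + s) * W (j + 1)) * w $ s)"
      by (subst sum.swap) (simp add: sum_distrib_right mult.assoc)
    also have "\<dots> = (\<Sum>s<m. ?c * (rat_mat_eval (R_mat \<beta> \<xi> \<sigma> D m N) x $$ (r, s) * w $ s))"
      by (intro sum.cong refl) (simp only: coeff lessThan_iff mult.assoc)
    also have "\<dots> = ?c * (rat_mat_eval (R_mat \<beta> \<xi> \<sigma> D m N) x *\<^sub>v w) $ r"
      using r by (simp add: scalar_prod_def atLeast0LessThan R_mat_def w_def sum_distrib_left)
    finally show "(rat_mat_eval (R_mat \<beta> \<xi> \<sigma> D m N) x *\<^sub>v w) $ r = 0\<^sub>v m $ r"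
      using c0 r by simp
  qed (simp add: R_mat_def)
  have "w = 0\<^sub>v m"
    by (rule invertible_mat_kernel_trivial[OF R _ _ Rw]) (simp_all add: R_mat_def w_def)
  show ?thesis
  proof (rule eq_vecI)
    fix i assume "i < dim_vec (0\<^sub>v ?n :: 'a vec)"
    then have i: "i < ?n" by simp
    then have "m > 0" by (cases m) auto
    have "i div m < N - 1" using i by (simp add: less_mult_imp_div_less mult.commute)
    then have "v $ (i div m * m + i mod m) = W (i div m + 1) * w $ (i mod m)"
      using \<open>m > 0\<close> by (intro vW) auto
    then show "v $ i = 0\<^sub>v ?n $ i" using i \<open>w = 0\<^sub>v m\<close> \<open>m > 0\<close> by simp
  qed (use v in simp)
qed

text \<open>Full column rank means that the two blocks have no common nonzero kernel vector. If no
  \<open>g_poly\<close> vanishes, \<open>A_mat\<close> at \<open>x\<close> is already injective;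
  otherwise \<open>kernel_system_trivial\<close> applies.\<close>

lemma column_rank_system:
  fixes \<sigma> \<beta> :: "nat \<Rightarrow> 'a::field"
  assumes N: "N \<ge> 2" and \<beta>: "\<beta> N \<noteq> 0"
    and disj: "(\<forall>k\<in>{1..N - 1}. poly (g_poly \<beta> \<xi> k) x \<noteq> 0) \<or>
      (\<forall>j<N. poly (h_poly \<sigma> j) x \<noteq> 0) \<and> invertible_mat (rat_mat_eval (R_mat \<beta> \<xi> \<sigma> D m N) x)"
  shows "vec_space.rank (m * (N - 1) + m)
      (poly_mat_eval (A_mat \<beta> \<xi> \<sigma> m N @\<^sub>r C_mat \<beta> \<xi> \<sigma> D m N) x) = m * (N - 1)"
proof -
  let ?n = "m * (N - 1)"
  let ?A = "poly_mat_eval (A_mat \<beta> \<xi> \<sigma> m N) x" and ?C = "poly_mat_eval (C_mat \<beta> \<xi> \<sigma> D m N) x"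
  interpret vec_space "TYPE('a)" "?n + m" .
  have A: "?A \<in> carrier_mat ?n ?n" and C: "?C \<in> carrier_mat m ?n"
    by (intro carrier_matI; simp)+
  have "poly_mat_eval (A_mat \<beta> \<xi> \<sigma> m N @\<^sub>r C_mat \<beta> \<xi> \<sigma> D m N) x = ?A @\<^sub>r ?C"
    unfolding append_rows_def by (intro eq_matI) auto
  moreover have "rank (?A @\<^sub>r ?C) = ?n"
  proof (rule rank_eq_dim_col_if_injective)
    show "?A @\<^sub>r ?C \<in> carrier_mat (?n + m) ?n" using A C by simp
    fix v :: "'a vec"
    assume v: "v \<in> carrier_vec ?n" and "(?A @\<^sub>r ?C) *\<^sub>v v = 0\<^sub>v (?n + m)"
    moreover have "0\<^sub>v (?n + m) = 0\<^sub>v ?n @\<^sub>v (0\<^sub>v m :: 'a vec)"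
      by (intro eq_vecI) auto
    ultimately have "(?A *\<^sub>v v) @\<^sub>v (?C *\<^sub>v v) = 0\<^sub>v ?n @\<^sub>v 0\<^sub>v m"
      by (simp add: mat_mult_append[OF A C v])
    then have Av: "?A *\<^sub>v v = 0\<^sub>v ?n" and Cv: "?C *\<^sub>v v = 0\<^sub>v m"
      using A v by (simp_all add: append_vec_eq[of _ ?n])
    show "v = 0\<^sub>v ?n"
    proof (cases "\<forall>k\<in>{1..N - 1}. poly (g_poly \<beta> \<xi> k) x \<noteq> 0")
      case True
      have "i div m < N - 1" if "i < ?n" for i
        using that by (simp add: less_mult_imp_div_less mult.commute)
      then have "det ?A \<noteq> 0"
        unfolding det_A_mat_eval using True by fastforce
      then show ?thesis using det_0_iff_vec_prod_zero_field[OF A] v Av by auto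
    next
      case False
      with disj show ?thesis by (intro kernel_system_trivial[OF N \<beta> _ _ v Av Cv]) auto
    qed
  qed
  ultimately show ?thesis by simp
qed

section \<open>Regular equivalence and minimality combined at each point\<close>

theorem theorem6p5:
  fixes \<sigma> \<beta> :: "nat \<Rightarrow> 'a::alg_closed_field"
    and \<xi> :: "nat \<Rightarrow> 'a ext_point"
    and D :: "nat \<Rightarrow> 'a mat"
    and m N :: nat
  assumes "N \<ge> 2"
    and "\<And>i. 1 \<le> i \<Longrightarrow> i \<le> N \<Longrightarrow> \<xi> i \<noteq> Finite 0"
    and "\<And>i. i \<le> N \<Longrightarrow> \<beta> i \<noteq> 0"
    and "\<And>i. i \<le> N \<Longrightarrow> D i \<in> carrier_mat m m"
    and "\<And>i j. 1 \<le> i \<Longrightarrow> i \<le> N \<Longrightarrow> j \<le> N - 1 \<Longrightarrow> \<xi> i \<noteq> Finite (\<sigma> j)"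
    and "\<And>x. x \<in> finite_poles \<xi> (N - 1) \<Longrightarrow>
           invertible_mat (rat_mat_eval (R_mat \<beta> \<xi> \<sigma> D m N) x)"
  shows "is_linearization (L_mat \<beta> \<xi> \<sigma> D m N) (A_mat \<beta> \<xi> \<sigma> m N) (Q_mat \<beta> \<xi> \<sigma> D m N)
           (case \<xi> N of Infinity \<Rightarrow> UNIV | Finite x \<Rightarrow> UNIV - {x})"
proof -
  let ?\<Sigma> = "case \<xi> N of Infinity \<Rightarrow> UNIV | Finite x \<Rightarrow> UNIV - {x}"
  let ?D = "D_mat \<beta> \<xi> \<sigma> D m N" and ?C = "C_mat \<beta> \<xi> \<sigma> D m N"
    and ?B = "B_mat \<beta> \<xi> \<sigma> m N" and ?A = "A_mat \<beta> \<xi> \<sigma> m N" and ?Q = "Q_mat \<beta> \<xi> \<sigma> D m N"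
  let ?T = "transfer_function ?D ?C ?B ?A"
  let ?p = "Polynomial.smult (\<beta> 0 / \<beta> N) (g_poly \<beta> \<xi> N)"
  have "\<exists>y::'a. y \<noteq> x" for x by (rule exI[of _ "x + 1"]) simp
  then have nonempty: "?\<Sigma> \<noteq> {}" by (auto split: ext_point.split)
  \<comment> \<open>Minimality holds at every point of the field; a finite \<open>\<xi> N\<close> is
    excluded because the scalar \<open>?p\<close> vanishes there.\<close>
  have minimal: "minimal_at ?C ?B ?A x" for x
  proof -
    \<comment> \<open>A zero of \<open>g_poly\<close> with index at most \<open>N - 1\<close> is a
      finite pole, so \<open>R_mat\<close> is nonsingular there, and \<open>x\<close> differs from
      every \<open>\<sigma> j\<close>.\<close>
    have h: "poly (h_poly \<sigma> j) x \<noteq> 0"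
      and R: "invertible_mat (rat_mat_eval (R_mat \<beta> \<xi> \<sigma> D m N) x)"
      if k: "k \<in> {1..N - 1}" "poly (g_poly \<beta> \<xi> k) x = 0" and "j < N" for k j
    proof -
      have "k \<le> N" using k by auto
      then have "\<xi> k = Finite x" using k assms(2,3)[of k] by (subst (asm) poly_g_poly_eq_0_iff) auto
      then show "invertible_mat (rat_mat_eval (R_mat \<beta> \<xi> \<sigma> D m N) x)"
        using k by (intro assms(6)) (auto simp: finite_poles_def)
      have "\<xi> k \<noteq> Finite (\<sigma> j)" using k \<open>j < N\<close> by (intro assms(5)) auto
      then show "poly (h_poly \<sigma> j) x \<noteq> 0" using \<open>\<xi> k = Finite x\<close> by (auto simp: h_poly_def)
    qed
    have "\<beta> N \<noteq> 0" using assms(3) by simp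
    moreover have "(\<forall>k\<in>{1..N - 1}. poly (g_poly \<beta> \<xi> k) x \<noteq> 0) \<or>
        (\<forall>j<N. poly (h_poly \<sigma> j) x \<noteq> 0) \<and> invertible_mat (rat_mat_eval (R_mat \<beta> \<xi> \<sigma> D m N) x)"
    proof (cases "\<forall>k\<in>{1..N - 1}. poly (g_poly \<beta> \<xi> k) x \<noteq> 0")
      case False
      then obtain k where k: "k \<in> {1..N - 1}" "poly (g_poly \<beta> \<xi> k) x = 0" by auto
      then show ?thesis using h[OF k] R[OF k, of 0] assms(1) by auto
    qed simp
    ultimately show ?thesis
      using column_rank_system[OF assms(1), of \<beta> \<xi> x \<sigma> D m] row_rank_system[OF assms(1), of \<beta> \<xi> x \<sigma> m]
      by (auto simp: minimal_at_def append_rows_def)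
  qed
  have T: "?T = to_fract ?p \<cdot>\<^sub>m ?Q"
    using transfer_function_L_mat[of N \<beta>, OF assms(1,3)] by simp
  have Q: "?Q \<in> carrier_mat m m" by (simp add: Q_mat_def)
  have "\<exists>s1 s2 R1 R2. int s1 - int s2 = int m - int m \<and> int m - int m = int m - int m \<and>
      R1 \<in> carrier_mat (m + s1) (m + s1) \<and> rational_regular_at R1 x \<and>
      R2 \<in> carrier_mat (m + s1) (m + s1) \<and> rational_regular_at R2 x \<and>
      R1 * diag_block_mat [?Q, 1\<^sub>m s1] * R2 = diag_block_mat [?T, 1\<^sub>m s2]"
    if "x \<in> ?\<Sigma>" for x
  proof -
    have "\<xi> N \<noteq> Finite x" using that by auto
    then have "poly (g_poly \<beta> \<xi> N) x \<noteq> 0"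
      using assms(1) assms(2,3)[of N] by (subst poly_g_poly_eq_0_iff) auto
    then have "poly ?p x \<noteq> 0" using assms(3)[of 0] assms(3)[of N] by simp
    then have "rational_regular_at (to_fract ?p \<cdot>\<^sub>m 1\<^sub>m m) x"
      by (rule rational_regular_at_scalar)
    moreover have "rational_regular_at (1\<^sub>m m) x"
    proof -
      have "to_fract 1 \<cdot>\<^sub>m 1\<^sub>m m = (1\<^sub>m m :: 'a poly fract mat)" by (intro eq_matI) auto
      then show ?thesis using rational_regular_at_scalar[of 1 x m] by simp
    qed
    moreover have "diag_block_mat [G, 1\<^sub>m 0] = G" for G :: "'a poly fract mat"
      by (intro eq_matI) (auto simp: Let_def)
    moreover have "(to_fract ?p \<cdot>\<^sub>m 1\<^sub>m m) * ?Q * 1\<^sub>m m = ?T"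
      using Q by (simp add: T mult_smult_assoc_mat[OF one_carrier_mat Q])
    ultimately show ?thesis
      by (intro exI[of _ 0] exI[of _ "to_fract ?p \<cdot>\<^sub>m 1\<^sub>m m"] exI[of _ "1\<^sub>m m"]) simp
  qed
  moreover have "dim_row ?Q = m" "dim_col ?Q = m" "dim_row ?D = m" "dim_col ?D = m"
    by (simp_all add: Q_mat_def)
  ultimately show ?thesis
    unfolding is_linearization_def Let_def
    by (intro conjI exI[of _ ?D] exI[of _ ?C] exI[of _ ?B] ballI nonempty linear_L_mat minimal
        polynomial_system_matrix_L_mat[of N \<beta>, OF assms(1,3)]) simp_all
qed

end
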